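(* Let $(\mathcal X,\mathsf d,P)$ be any metric probability space, and let $X$, $V$, $L_V(X)$, $q(V)$ and $H_3(P,\mathsf d)$ be the query, prototype triple, farthest-prototype label, conditional label-probability vector and farthest-cell triplet entropy defined in the context. Then $$\log 3-H_3(P,\mathsf d)=I\{L_V(X);V\},$$ where $I$ denotes mutual information, and hence $$0\le H_3(P,\mathsf d)\le\log3 .$$ Equality in the upper bound holds if and only if $q(V)=(1/3,1/3,1/3)$ almost surely. Moreover, the value of $H_3$ is unchanged when every dissimilarity is transformed by a common strictly increasing function (that is, when $\mathsf d(x,y)$ is replaced by $g(\mathsf d(x,y))$ for a strictly increasing $g:[0,\infty)\to\mathbb R$, the labels and $H_3$ being defined by the same formulas even if the triangle inequality fails); in particular, it is invariant to global metric rescaling $\mathsf d\mapsto c\,\mathsf d$, $c>0$.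
   Context: A metric probability space is a metric space $(\mathcal X,\mathsf d)$ with a probability measure $P$, with $\mathsf d$ measurable so that the quantities below are defined. Draw a query $X\sim P$ and a prototype triple $V=(V_1,V_2,V_3)\sim P^3$ independently. For fixed $v=(v_1,v_2,v_3)$ let $L_v(X)\in\arg\max_{1\le i\le3}\mathsf d(X,v_i)$ be the farthest-prototype label, with independent uniform randomization among exact ties. Define $q_i(v)=\mathbb P\{L_V(X)=i\mid V=v\}$, $q(v)=(q_1(v),q_2(v),q_3(v))$, and for a probability vector $q$ let $h(q)=-\sum_{i=1}^3q_i\log q_i$ (natural logarithm, $0\log0=0$). The farthest-cell triplet entropy is the conditional Shannon entropy $$H_3(P,\mathsf d)=H\{L_V(X)\mid V\}=\mathbb E_V\,h\{q(V)\}.$$ *)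

theory Defs
  imports "HOL-Probability.Probability"
begin

text \<open>The sigma-algebra on the space is arbitrary, subject only to joint measurability of the
  metric; it need not be the Borel sigma-algebra of \<open>d\<close>.\<close>

locale metric_prob_space = prob_space P + Metric_space "space P" d
  for P :: "'a measure" and d :: "'a \<Rightarrow> 'a \<Rightarrow> real" +
  assumes metric_measurable: "case_prod d \<in> borel_measurable (P \<Otimes>\<^sub>M P)"

text \<open>Prototype triples are functions on the index set \<open>{1..3}\<close>. The definitions below make sense
  for an arbitrary dissimilarity \<open>d\<close>, which need not be a metric.\<close>

definition proto_measure :: "'a measure \<Rightarrow> (nat \<Rightarrow> 'a) measure" where
  "proto_measure P = (\<Pi>\<^sub>M i\<in>{1..3}. P)"

definition farthest_set :: "('a \<Rightarrow> 'a \<Rightarrow> real) \<Rightarrow> (nat \<Rightarrow> 'a) \<Rightarrow> 'a \<Rightarrow> nat set" where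
  "farthest_set d v x = {i. is_arg_max (\<lambda>i. d x (v i)) (\<lambda>i. i \<in> {1..3}) i}"

definition farthest_label :: "('a \<Rightarrow> 'a \<Rightarrow> real) \<Rightarrow> (nat \<Rightarrow> 'a) \<Rightarrow> 'a \<Rightarrow> nat pmf" where
  "farthest_label d v x = pmf_of_set (farthest_set d v x)"

text \<open>Joint law of \<open>((X, V), L\<^sub>V(X))\<close>: \<open>X\<close> and \<open>V\<close> are independent, and given \<open>(X, V)\<close> the label
  is uniform on the set of maximisers.\<close>

definition farthest_experiment ::
    "'a measure \<Rightarrow> ('a \<Rightarrow> 'a \<Rightarrow> real) \<Rightarrow> (('a \<times> (nat \<Rightarrow> 'a)) \<times> nat) measure" where
  "farthest_experiment P d =
     (P \<Otimes>\<^sub>M proto_measure P) \<bind> (\<lambda>(x, v).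
       measure_pmf (farthest_label d v x) \<bind> (\<lambda>i.
         return ((P \<Otimes>\<^sub>M proto_measure P) \<Otimes>\<^sub>M count_space UNIV) ((x, v), i)))"

abbreviation protos :: "('a \<times> (nat \<Rightarrow> 'a)) \<times> nat \<Rightarrow> nat \<Rightarrow> 'a" where
  "protos \<omega> \<equiv> snd (fst \<omega>)"

abbreviation label :: "('a \<times> (nat \<Rightarrow> 'a)) \<times> nat \<Rightarrow> nat" where
  "label \<omega> \<equiv> snd \<omega>"

text \<open>\<open>q\<^sub>i(v)\<close> is the version of the conditional probability given \<open>V = v\<close> obtained by
  freezing \<open>v\<close> and drawing only the query and the tie-break.\<close>

definition label_prob ::
    "'a measure \<Rightarrow> ('a \<Rightarrow> 'a \<Rightarrow> real) \<Rightarrow> (nat \<Rightarrow> 'a) \<Rightarrow> nat \<Rightarrow> real" where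
  "label_prob P d v i = measure (P \<bind> (\<lambda>x. measure_pmf (farthest_label d v x))) {i}"

text \<open>Since \<open>ln 0 = 0\<close>, the convention \<open>0 log 0 = 0\<close> is automatic.\<close>

definition shannon_entropy3 :: "(nat \<Rightarrow> real) \<Rightarrow> real" where
  "shannon_entropy3 q = - (\<Sum>i\<in>{1..3}. q i * ln (q i))"

definition H3 :: "'a measure \<Rightarrow> ('a \<Rightarrow> 'a \<Rightarrow> real) \<Rightarrow> real" where
  "H3 P d = (\<integral>v. shannon_entropy3 (label_prob P d v) \<partial>proto_measure P)"

text \<open>Mutual information of the label and the triple, in natural units (base \<open>exp 1\<close>).\<close>

definition label_information :: "'a measure \<Rightarrow> ('a \<Rightarrow> 'a \<Rightarrow> real) \<Rightarrow> real" where
  "label_information P d =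
     prob_space.mutual_information (farthest_experiment P d) (exp 1)
       (count_space UNIV) (proto_measure P) label protos"


lemma farthest_set_subset: "farthest_set d v x \<subseteq> {1..3}"
  by (auto simp: farthest_set_def is_arg_max_def)

lemma finite_farthest_set [simp]: "finite (farthest_set d v x)"
  by (rule finite_subset[OF farthest_set_subset finite_atLeastAtMost])

lemma farthest_set_nonempty [simp]: "farthest_set d v x \<noteq> {}"
proof -
  have "Max ((\<lambda>i. d x (v i)) ` {1..3::nat}) \<in> (\<lambda>i. d x (v i)) ` {1..3}"
    by (rule Max_in) auto
  then obtain i where i: "i \<in> {1..3}" "Max ((\<lambda>i. d x (v i)) ` {1..3::nat}) = d x (v i)"
    by (elim imageE)
  then have "d x (v j) \<le> d x (v i)" if "j \<in> {1..3}" for j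
    using that by (metis Max_ge finite_atLeastAtMost finite_imageI imageI)
  then show ?thesis
    using i by (auto simp: farthest_set_def is_arg_max_linorder)
qed

context metric_prob_space
begin

lemma prob_space_proto_measure: "prob_space (proto_measure P)"
  unfolding proto_measure_def by (intro prob_space_PiM prob_space_axioms)

lemma measurable_farthest_label:
  "(\<lambda>(x, v). farthest_label d v x) \<in> measurable (P \<Otimes>\<^sub>M proto_measure P) (count_space UNIV)"
proof -
  note [measurable] = metric_measurable
  have [measurable]: "(\<lambda>(x, v). d x (v i)) \<in> borel_measurable (P \<Otimes>\<^sub>M proto_measure P)"
    if "i \<in> {1..3}" for i
  proof -
    have "(\<lambda>(x, v). (x, v i)) \<in> P \<Otimes>\<^sub>M proto_measure P \<rightarrow>\<^sub>M P \<Otimes>\<^sub>M P"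
      unfolding proto_measure_def using that by measurable
    from measurable_compose[OF this metric_measurable] show ?thesis
      by (simp add: split_beta')
  qed
  have "(\<lambda>p. farthest_set d (snd p) (fst p)) \<in>
      P \<Otimes>\<^sub>M proto_measure P \<rightarrow>\<^sub>M count_space (Pow {1..3})"
    unfolding measurable_count_space_eq2[OF finite_Pow_iff[THEN iffD2, OF finite_atLeastAtMost]]
  proof (intro conjI ballI)
    show "(\<lambda>p. farthest_set d (snd p) (fst p)) \<in> space (P \<Otimes>\<^sub>M proto_measure P) \<rightarrow> Pow {1..3}"
      by (intro Pi_I PowI farthest_set_subset)
    fix S :: "nat set" assume "S \<in> Pow {1..3}"
    then have S: "S \<subseteq> {1..3}" by (rule PowD)
    have eq: "farthest_set d v x = S \<longleftrightarrow>
       (\<forall>i\<in>{1..3}. i \<in> S \<longleftrightarrow> (\<forall>j\<in>{1..3}. d x (v j) \<le> d x (v i)))" for x v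
    proof -
      have "farthest_set d v x = S \<longleftrightarrow> (\<forall>i\<in>{1..3}. i \<in> S \<longleftrightarrow> i \<in> farthest_set d v x)"
        using S farthest_set_subset[of d v x] by (simp only: set_eq_iff subset_iff) metis
      also have "\<dots> \<longleftrightarrow> (\<forall>i\<in>{1..3}. i \<in> S \<longleftrightarrow> (\<forall>j\<in>{1..3}. d x (v j) \<le> d x (v i)))"
        by (intro ball_cong refl) (simp add: farthest_set_def is_arg_max_linorder Ball_def)
      finally show ?thesis .
    qed
    have "(\<lambda>p. farthest_set d (snd p) (fst p)) -` {S} \<inter> space (P \<Otimes>\<^sub>M proto_measure P) =
       {p \<in> space (P \<Otimes>\<^sub>M proto_measure P). \<forall>i\<in>{1..3}.
          i \<in> S \<longleftrightarrow> (\<forall>j\<in>{1..3}. (case p of (x, v) \<Rightarrow> d x (v j)) \<le> (case p of (x, v) \<Rightarrow> d x (v i)))}"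
      unfolding vimage_def Int_def split_beta' mem_Collect_eq singleton_iff eq
      by (intro Collect_cong conj_commute)
    also have "\<dots> \<in> sets (P \<Otimes>\<^sub>M proto_measure P)"
      by measurable
    finally show "(\<lambda>p. farthest_set d (snd p) (fst p)) -` {S} \<inter> space (P \<Otimes>\<^sub>M proto_measure P)
        \<in> sets (P \<Otimes>\<^sub>M proto_measure P)" .
  qed
  from measurable_compose[OF this, of pmf_of_set "count_space UNIV"] show ?thesis
    by (simp add: farthest_label_def split_beta')
qed

lemma measurable_label_kernel:
  "(\<lambda>(x, v). measure_pmf (farthest_label d v x)) \<in>
     P \<Otimes>\<^sub>M proto_measure P \<rightarrow>\<^sub>M prob_algebra (count_space UNIV)"
proof -
  have "measure_pmf \<in> count_space UNIV \<rightarrow>\<^sub>M prob_algebra (count_space (UNIV::nat set))"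
    by (auto simp: space_prob_algebra prob_space_measure_pmf)
  from measurable_compose[OF measurable_farthest_label this] show ?thesis
    by (simp add: split_beta')
qed

lemma measurable_label_kernel_fixed:
  assumes "v \<in> space (proto_measure P)"
  shows "(\<lambda>x. measure_pmf (farthest_label d v x)) \<in> P \<rightarrow>\<^sub>M prob_algebra (count_space UNIV)"
  using measurable_compose[OF measurable_Pair2'[OF assms] measurable_label_kernel] by simp

lemma measurable_experiment_kernel:
  "(\<lambda>(x, v). measure_pmf (farthest_label d v x) \<bind> (\<lambda>i.
         return ((P \<Otimes>\<^sub>M proto_measure P) \<Otimes>\<^sub>M count_space UNIV) ((x, v), i)))
   \<in> P \<Otimes>\<^sub>M proto_measure P \<rightarrow>\<^sub>M prob_algebra ((P \<Otimes>\<^sub>M proto_measure P) \<Otimes>\<^sub>M count_space UNIV)"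
proof -
  have "(\<lambda>p. (case p of (x, v) \<Rightarrow> measure_pmf (farthest_label d v x)) \<bind> (\<lambda>i.
         return ((P \<Otimes>\<^sub>M proto_measure P) \<Otimes>\<^sub>M count_space UNIV) (p, i)))
   \<in> P \<Otimes>\<^sub>M proto_measure P \<rightarrow>\<^sub>M prob_algebra ((P \<Otimes>\<^sub>M proto_measure P) \<Otimes>\<^sub>M count_space UNIV)"
    by (rule measurable_bind_prob_space2[OF measurable_label_kernel]) measurable
  then show ?thesis by (simp add: split_beta')
qed

lemma
  shows prob_space_experiment: "prob_space (farthest_experiment P d)"
    and sets_experiment: "sets (farthest_experiment P d) =
      sets ((P \<Otimes>\<^sub>M proto_measure P) \<Otimes>\<^sub>M count_space UNIV)"
proof -
  interpret Q: prob_space "proto_measure P" by (rule prob_space_proto_measure)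
  interpret PQ: pair_prob_space P "proto_measure P" ..
  have "P \<Otimes>\<^sub>M proto_measure P \<in> space (prob_algebra (P \<Otimes>\<^sub>M proto_measure P))"
    by (simp add: space_prob_algebra PQ.prob_space_axioms)
  from prob_space_bind'[OF this measurable_experiment_kernel]
    sets_bind'[OF this measurable_experiment_kernel]
  show "prob_space (farthest_experiment P d)" "sets (farthest_experiment P d) =
      sets ((P \<Otimes>\<^sub>M proto_measure P) \<Otimes>\<^sub>M count_space UNIV)"
    by (simp_all add: farthest_experiment_def)
qed

lemma label_prob_eq:
  assumes v: "v \<in> space (proto_measure P)"
  shows "ennreal (label_prob P d v i) = (\<integral>\<^sup>+x. pmf (farthest_label d v x) i \<partial>P)"
proof -
  have P: "P \<in> space (prob_algebra P)"
    by (simp add: space_prob_algebra prob_space_axioms)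
  note k = measurable_label_kernel_fixed[OF v]
  interpret B: prob_space "P \<bind> (\<lambda>x. measure_pmf (farthest_label d v x))"
    by (rule prob_space_bind'[OF P k])
  have "ennreal (label_prob P d v i) = emeasure (P \<bind> (\<lambda>x. measure_pmf (farthest_label d v x))) {i}"
    by (simp add: label_prob_def B.emeasure_eq_measure)
  also have "\<dots> = (\<integral>\<^sup>+x. emeasure (measure_pmf (farthest_label d v x)) {i} \<partial>P)"
    by (rule emeasure_bind_prob_algebra[OF P k]) auto
  finally show ?thesis by (simp add: emeasure_pmf_single)
qed

lemma emeasure_experiment:
  assumes A: "A \<in> sets (proto_measure P)" and B: "B \<in> sets P"
  shows "emeasure (farthest_experiment P d) ((B \<times> A) \<times> {i}) =
    (\<integral>\<^sup>+v. indicator A v * (\<integral>\<^sup>+x. indicator B x * ennreal (pmf (farthest_label d v x) i) \<partial>P) \<partial>proto_measure P)"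
proof -
  interpret Q: prob_space "proto_measure P" by (rule prob_space_proto_measure)
  interpret PQ: pair_prob_space P "proto_measure P" ..
  let ?N = "(P \<Otimes>\<^sub>M proto_measure P) \<Otimes>\<^sub>M count_space (UNIV::nat set)"
  have PQ: "P \<Otimes>\<^sub>M proto_measure P \<in> space (prob_algebra (P \<Otimes>\<^sub>M proto_measure P))"
    by (simp add: space_prob_algebra PQ.prob_space_axioms)
  have S: "(B \<times> A) \<times> {i} \<in> sets ?N" using A B by auto
  have *: "emeasure (case p of (x, v) \<Rightarrow> measure_pmf (farthest_label d v x) \<bind> (\<lambda>i. return ?N ((x, v), i)))
       ((B \<times> A) \<times> {i}) = indicator A (snd p) * (indicator B (fst p) * ennreal (pmf (farthest_label d (snd p) (fst p)) i))"
    if p: "p \<in> space (P \<Otimes>\<^sub>M proto_measure P)" for p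
  proof -
    obtain x v where [simp]: "p = (x, v)" by force
    have k: "(\<lambda>i. return ?N ((x, v), i)) \<in> count_space UNIV \<rightarrow>\<^sub>M prob_algebra ?N"
      using p by (auto simp: space_prob_algebra space_pair_measure intro!: prob_space_return)
    have "emeasure (measure_pmf (farthest_label d v x) \<bind> (\<lambda>i. return ?N ((x, v), i))) ((B \<times> A) \<times> {i})
      = (\<integral>\<^sup>+j. emeasure (return ?N ((x, v), j)) ((B \<times> A) \<times> {i}) \<partial>measure_pmf (farthest_label d v x))"
      by (rule emeasure_bind_prob_algebra[OF _ k S])
         (simp add: space_prob_algebra prob_space_measure_pmf)
    also have "\<dots> = (\<integral>\<^sup>+j. indicator A v * indicator B x * indicator {i} j \<partial>measure_pmf (farthest_label d v x))"
      using S by (intro nn_integral_cong) (auto simp: emeasure_return indicator_def)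
    also have "\<dots> = indicator A v * indicator B x * ennreal (pmf (farthest_label d v x) i)"
      by (simp add: nn_integral_cmult emeasure_pmf_single)
    finally show ?thesis by (simp add: mult.assoc)
  qed
  have [measurable]: "(\<lambda>p. pmf (farthest_label d (snd p) (fst p)) i) \<in> borel_measurable (P \<Otimes>\<^sub>M proto_measure P)"
    using measurable_compose[OF measurable_farthest_label, of "\<lambda>q. pmf q i" borel]
    by (simp add: split_beta')
  note [measurable] = A B
  have "emeasure (farthest_experiment P d) ((B \<times> A) \<times> {i}) =
    (\<integral>\<^sup>+p. indicator A (snd p) * (indicator B (fst p) * ennreal (pmf (farthest_label d (snd p) (fst p)) i))
      \<partial>(P \<Otimes>\<^sub>M proto_measure P))"
    unfolding farthest_experiment_def
    by (subst emeasure_bind_prob_algebra[OF PQ measurable_experiment_kernel S])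
       (intro nn_integral_cong *)
  also have "\<dots> = (\<integral>\<^sup>+v. \<integral>\<^sup>+x. indicator A v * (indicator B x * ennreal (pmf (farthest_label d v x) i)) \<partial>P \<partial>proto_measure P)"
    by (subst PQ.nn_integral_snd[symmetric]) (auto simp: split_beta')
  also have "\<dots> = (\<integral>\<^sup>+v. indicator A v * (\<integral>\<^sup>+x. indicator B x * ennreal (pmf (farthest_label d v x) i) \<partial>P) \<partial>proto_measure P)"
  proof (intro nn_integral_cong nn_integral_cmult)
    fix v assume "v \<in> space (proto_measure P)"
    then have [measurable]: "(\<lambda>x. pmf (farthest_label d v x) i) \<in> borel_measurable P"
      using measurable_compose[OF measurable_Pair2' measurable_compose[OF measurable_farthest_label, of "\<lambda>q. pmf q i" borel]]
      by simp
    show "(\<lambda>x. indicator B x * ennreal (pmf (farthest_label d v x) i)) \<in> borel_measurable P"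
      by measurable
  qed
  finally show ?thesis .
qed

text \<open>The numbers \<open>q\<^sub>i(v)\<close> are a version of the conditional probabilities of the label given \<open>V\<close>.\<close>

lemma label_prob_conditional:
  assumes A: "A \<in> sets (proto_measure P)"
  shows "emeasure (farthest_experiment P d)
       {\<omega> \<in> space (farthest_experiment P d). label \<omega> = i \<and> protos \<omega> \<in> A} =
     (\<integral>\<^sup>+v\<in>A. label_prob P d v i \<partial>proto_measure P)"
proof -
  have "{\<omega> \<in> space (farthest_experiment P d). label \<omega> = i \<and> protos \<omega> \<in> A} = (space P \<times> A) \<times> {i}"
    using sets_eq_imp_space_eq[OF sets_experiment] sets.sets_into_space[OF A]
    by (auto simp: space_pair_measure)
  then have "emeasure (farthest_experiment P d)
       {\<omega> \<in> space (farthest_experiment P d). label \<omega> = i \<and> protos \<omega> \<in> A} =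
     (\<integral>\<^sup>+v. indicator A v * (\<integral>\<^sup>+x. indicator (space P) x * ennreal (pmf (farthest_label d v x) i) \<partial>P) \<partial>proto_measure P)"
    by (simp add: emeasure_experiment A)
  also have "\<dots> = (\<integral>\<^sup>+v\<in>A. label_prob P d v i \<partial>proto_measure P)"
  proof (rule nn_integral_cong)
    fix v assume v: "v \<in> space (proto_measure P)"
    have "(\<integral>\<^sup>+x. indicator (space P) x * ennreal (pmf (farthest_label d v x) i) \<partial>P) =
        ennreal (label_prob P d v i)"
      unfolding label_prob_eq[OF v] by (rule nn_integral_cong) simp
    then show "indicator A v * (\<integral>\<^sup>+x. indicator (space P) x * ennreal (pmf (farthest_label d v x) i) \<partial>P) =
        ennreal (label_prob P d v i) * indicator A v"
      by (simp only: mult.commute)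
  qed
  finally show ?thesis .
qed
end

end

theory Submission
  imports Defs
begin

text \<open>Everything rests on the fact that the label is uniform on \<open>{1, 2, 3}\<close>: the three prototypes are
  exchangeable and the tie-break is symmetric, so permuting the prototypes permutes the label
  (\<open>pmf_farthest_label_permute\<close>) without changing the law of the triple, whence
  \<open>E q\<^sub>i(V) = 1/3\<close> (\<open>nn_integral_label_prob\<close>).

  The pair \<open>(L, V)\<close> has density \<open>q\<^sub>i(v)\<close> with respect to counting measure times the law of \<open>V\<close>,
  because \<open>q\<close> is a version of the conditional label probabilities. The product of the marginals has
  density \<open>1/3\<close> there. The mutual information, being the Kullback-Leibler divergence of these two laws,
  is therefore \<open>E (\<Sum>\<^sub>i q\<^sub>i ln (3 q\<^sub>i))\<close>, and the integrand is \<open>ln 3 - h(q)\<close>; this is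
  \<open>label_information_eq_deficit\<close>.

  The bounds and the equality case come from the pointwise Gibbs inequality: \<open>ln 3 - h(q)\<close> is
  nonnegative and vanishes only at the uniform vector, so its expectation vanishes only if \<open>q(V)\<close> is
  uniform almost surely. Finally, a maximiser of \<open>d(x, v\<^sub>i)\<close> depends only on the order of the three
  values, so an increasing transformation leaves even the label kernel unchanged.\<close>

section \<open>Entropy on three letters\<close>

text \<open>This is \<open>ln s \<le> s - 1\<close> at \<open>s = 1 / t\<close>, multiplied by \<open>t\<close>. With the tangent line at \<open>t = 1\<close>
  subtracted, \<open>t ln t\<close> becomes a nonnegative function with a single zero.\<close>

lemma mult_ln_ge_minus_one:
  fixes t :: real
  assumes "0 \<le> t"
  shows "t - 1 \<le> t * ln t"
proof (cases "t = 0")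
  case False
  with assms have t: "0 < t" by simp
  have "t * ln (1 / t) \<le> t * (1 / t - 1)"
    using t by (intro mult_left_mono ln_le_minus_one) auto
  with t show ?thesis by (simp add: ln_div algebra_simps)
qed simp

lemma mult_ln_eq_minus_one:
  fixes t :: real
  assumes "0 \<le> t" "t * ln t = t - 1"
  shows "t = 1"
proof -
  have t: "0 < t" using assms by (cases "t = 0") auto
  have "ln (1 / t) = 1 / t - 1"
    using assms(2) t by (simp add: ln_div field_simps)
  then have "1 / t = 1" using t by (intro ln_eq_minus_one) auto
  then show ?thesis using t by simp
qed

lemma entropy_deficit_eq_divergence:
  assumes nonneg: "\<And>i. i \<in> {1..3} \<Longrightarrow> 0 \<le> q i" and total: "(\<Sum>i\<in>{1..3}. q i) = 1"
  shows "ln 3 - shannon_entropy3 q = (\<Sum>i\<in>{1..3}. q i * ln (3 * q i))"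
proof -
  have "(\<Sum>i\<in>{1..3}. q i * ln (3 * q i)) = (\<Sum>i\<in>{1..3}. q i * ln 3 + q i * ln (q i))"
  proof (intro sum.cong refl)
    fix i :: nat assume "i \<in> {1..3}"
    then have "0 \<le> q i" by (rule nonneg)
    then show "q i * ln (3 * q i) = q i * ln 3 + q i * ln (q i)"
      by (cases "q i = 0") (auto simp: ln_mult algebra_simps)
  qed
  also have "\<dots> = (\<Sum>i\<in>{1..3}. q i) * ln 3 - shannon_entropy3 q"
    by (simp only: shannon_entropy3_def sum.distrib sum_distrib_right minus_minus diff_minus_eq_add)
  finally show ?thesis unfolding total by simp
qed

text \<open>Since the deviations \<open>3 q\<^sub>i - 1\<close> cancel in the sum, the deficit is an average of the
  nonnegative terms \<open>t ln t - (t - 1)\<close> at \<open>t = 3 q\<^sub>i\<close>, each of which vanishes only at \<open>t = 1\<close>.\<close>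

lemma entropy_deficit_eq_convexity_gap:
  assumes nonneg: "\<And>i. i \<in> {1..3} \<Longrightarrow> 0 \<le> q i" and total: "(\<Sum>i\<in>{1..3}. q i) = 1"
  shows "ln 3 - shannon_entropy3 q =
    (\<Sum>i\<in>{1..3}. 3 * q i * ln (3 * q i) - (3 * q i - 1)) / 3"
proof -
  have "(\<Sum>i\<in>{1..3}. 3 * q i * ln (3 * q i) - (3 * q i - 1)) =
      3 * (\<Sum>i\<in>{1..3}. q i * ln (3 * q i)) - (3 * (\<Sum>i\<in>{1..3}. q i) - 3)"
    by (simp add: sum_subtractf sum_distrib_left mult.assoc)
  then show ?thesis
    using entropy_deficit_eq_divergence[OF assms] total by simp
qed

lemma shannon_entropy3_le:
  assumes nonneg: "\<And>i. i \<in> {1..3} \<Longrightarrow> 0 \<le> q i" and total: "(\<Sum>i\<in>{1..3}. q i) = 1"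
  shows "shannon_entropy3 q \<le> ln 3"
proof -
  have "0 \<le> (\<Sum>i\<in>{1..3}. 3 * q i * ln (3 * q i) - (3 * q i - 1))"
    using nonneg by (intro sum_nonneg) (simp add: mult_ln_ge_minus_one)
  then show ?thesis
    using entropy_deficit_eq_convexity_gap[OF assms] by linarith
qed

lemma shannon_entropy3_eq_ln3_iff:
  assumes nonneg: "\<And>i. i \<in> {1..3} \<Longrightarrow> 0 \<le> q i" and total: "(\<Sum>i\<in>{1..3}. q i) = 1"
  shows "shannon_entropy3 q = ln 3 \<longleftrightarrow> (\<forall>i\<in>{1..3}. q i = 1 / 3)"
proof
  assume "shannon_entropy3 q = ln 3"
  then have "(\<Sum>i\<in>{1..3}. 3 * q i * ln (3 * q i) - (3 * q i - 1)) = 0"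
    using entropy_deficit_eq_convexity_gap[OF assms] by linarith
  moreover have "0 \<le> 3 * q i * ln (3 * q i) - (3 * q i - 1)" if "i \<in> {1..3}" for i
    using mult_ln_ge_minus_one[of "3 * q i"] nonneg[OF that] by simp
  ultimately have gap: "\<forall>i\<in>{1..3}. 3 * q i * ln (3 * q i) - (3 * q i - 1) = 0"
    by (subst (asm) sum_nonneg_eq_0_iff) auto
  show "\<forall>i\<in>{1..3}. q i = 1 / 3"
  proof
    fix i :: nat assume i: "i \<in> {1..3}"
    then have "3 * q i = 1"
      using gap nonneg[OF i] by (intro mult_ln_eq_minus_one) auto
    then show "q i = 1 / 3" by simp
  qed
next
  assume uniform: "\<forall>i\<in>{1..3}. q i = 1 / 3"
  have "shannon_entropy3 q = - (\<Sum>i\<in>{1..3::nat}. (1 / 3) * ln (1 / 3))"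
    unfolding shannon_entropy3_def
    by (intro arg_cong[where f=uminus] sum.cong refl) (simp only: uniform[rule_format])
  also have "\<dots> = ln 3" by (simp add: ln_div)
  finally show "shannon_entropy3 q = ln 3" .
qed

lemma shannon_entropy3_nonneg:
  assumes "\<And>i. i \<in> {1..3} \<Longrightarrow> 0 \<le> q i" "\<And>i. i \<in> {1..3} \<Longrightarrow> q i \<le> 1"
  shows "0 \<le> shannon_entropy3 q"
proof -
  have "q i * ln (q i) \<le> 0" if "i \<in> {1..3}" for i
    using assms[OF that] by (cases "q i = 0") (auto intro!: mult_nonneg_nonpos)
  then show ?thesis
    unfolding shannon_entropy3_def by (simp add: sum_nonpos del: atLeastAtMost_iff)
qed

section \<open>Joint densities of a discrete and a general random variable\<close>

text \<open>To identify a joint density when one variable is discrete it suffices to look at one value of that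
  variable at a time: a measurable set in the product is the countable disjoint union of its slices.\<close>

lemma distributed_discrete_pairI:
  fixes L :: "'w \<Rightarrow> nat"
  assumes T: "sigma_finite_measure T"
    and L [measurable]: "L \<in> M \<rightarrow>\<^sub>M count_space UNIV" and Y [measurable]: "Y \<in> M \<rightarrow>\<^sub>M T"
    and r [measurable]: "\<And>i. r i \<in> borel_measurable T"
    and slice: "\<And>i A. A \<in> sets T \<Longrightarrow>
      emeasure M {\<omega> \<in> space M. L \<omega> = i \<and> Y \<omega> \<in> A} = (\<integral>\<^sup>+y\<in>A. r i y \<partial>T)"
  shows "distributed M (count_space UNIV \<Otimes>\<^sub>M T) (\<lambda>\<omega>. (L \<omega>, Y \<omega>)) (\<lambda>(i, y). r i y)"
  unfolding distributed_def
proof (intro conjI)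
  interpret T: sigma_finite_measure T by fact
  show [measurable]: "(\<lambda>(i, y). r i y) \<in> borel_measurable (count_space UNIV \<Otimes>\<^sub>M T)"
    by (intro measurable_pair_measure_countable1) auto
  show meas [measurable]: "(\<lambda>\<omega>. (L \<omega>, Y \<omega>)) \<in> M \<rightarrow>\<^sub>M count_space UNIV \<Otimes>\<^sub>M T"
    by measurable
  show "distr M (count_space UNIV \<Otimes>\<^sub>M T) (\<lambda>\<omega>. (L \<omega>, Y \<omega>)) =
      density (count_space UNIV \<Otimes>\<^sub>M T) (\<lambda>(i, y). r i y)"
  proof (rule measure_eqI)
    fix A assume "A \<in> sets (distr M (count_space UNIV \<Otimes>\<^sub>M T) (\<lambda>\<omega>. (L \<omega>, Y \<omega>)))"
    then have A [measurable]: "A \<in> sets (count_space UNIV \<Otimes>\<^sub>M T)" by simp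
    define B where "B i = Pair i -` A" for i
    have B [measurable]: "B i \<in> sets T" for i
      unfolding B_def by (rule sets_Pair1[OF A])
    have "emeasure (distr M (count_space UNIV \<Otimes>\<^sub>M T) (\<lambda>\<omega>. (L \<omega>, Y \<omega>))) A =
        emeasure M (\<Union>i. {\<omega> \<in> space M. L \<omega> = i \<and> Y \<omega> \<in> B i})"
      by (subst emeasure_distr[OF meas A]) (auto simp: B_def intro!: arg_cong2[where f=emeasure])
    also have "\<dots> = (\<Sum>i. emeasure M {\<omega> \<in> space M. L \<omega> = i \<and> Y \<omega> \<in> B i})"
      by (intro suminf_emeasure[symmetric]) (auto simp: disjoint_family_on_def)
    also have "\<dots> = (\<Sum>i. \<integral>\<^sup>+y. r i y * indicator (B i) y \<partial>T)"
      by (simp add: slice)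
    also have "\<dots> = (\<integral>\<^sup>+i. \<integral>\<^sup>+y. (case (i, y) of (i, y) \<Rightarrow> r i y) * indicator A (i, y) \<partial>T \<partial>count_space UNIV)"
      by (subst nn_integral_count_space_nat) (simp add: B_def indicator_def)
    also have "\<dots> = emeasure (density (count_space UNIV \<Otimes>\<^sub>M T) (\<lambda>(i, y). r i y)) A"
      by (subst T.nn_integral_fst, measurable) (simp add: emeasure_density)
    finally show "emeasure (distr M (count_space UNIV \<Otimes>\<^sub>M T) (\<lambda>\<omega>. (L \<omega>, Y \<omega>))) A =
        emeasure (density (count_space UNIV \<Otimes>\<^sub>M T) (\<lambda>(i, y). r i y)) A" .
  qed simp
qed

lemma integral_count_space_pair_finite:
  fixes f :: "nat \<Rightarrow> 'b \<Rightarrow> real"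
  assumes T: "sigma_finite_measure T" and I: "finite I"
    and int: "\<And>i. i \<in> I \<Longrightarrow> integrable T (f i)"
    and zero: "\<And>i y. i \<notin> I \<Longrightarrow> y \<in> space T \<Longrightarrow> f i y = 0"
  shows "(\<integral>p. f (fst p) (snd p) \<partial>(count_space UNIV \<Otimes>\<^sub>M T)) = (\<Sum>i\<in>I. \<integral>y. f i y \<partial>T)"
proof -
  interpret pair_sigma_finite "count_space (UNIV :: nat set)" T
    by (intro pair_sigma_finite.intro T sigma_finite_measure_count_space)
  have int': "integrable T (f i)" for i
  proof (cases "i \<in> I")
    case False
    then have "integrable T (f i) \<longleftrightarrow> integrable T (\<lambda>_. 0 :: real)"
      by (intro Bochner_Integration.integrable_cong refl zero)
    then show ?thesis by simp
  qed (rule int)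
  have null: "(\<integral>y. norm (f i y) \<partial>T) = 0" "(\<integral>y. f i y \<partial>T) = 0" if "i \<notin> I" for i
    using zero[OF that] by (simp_all cong: Bochner_Integration.integral_cong)
  have "integrable (count_space UNIV \<Otimes>\<^sub>M T) (\<lambda>p. f (fst p) (snd p))"
  proof (rule Fubini_integrable)
    show "(\<lambda>p. f (fst p) (snd p)) \<in> borel_measurable (count_space UNIV \<Otimes>\<^sub>M T)"
      using int' by (intro measurable_pair_measure_countable1) auto
    have "summable (\<lambda>i. norm (\<integral>y. norm (f i y) \<partial>T))"
      using I null(1) by (intro summable_finite[of I]) auto
    then show "integrable (count_space UNIV) (\<lambda>i. \<integral>y. norm (f (fst (i, y)) (snd (i, y))) \<partial>T)"
      by (simp add: integrable_count_space_nat_iff)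
  qed (simp add: int')
  from integral_fst'[OF this] have "(\<integral>p. f (fst p) (snd p) \<partial>(count_space UNIV \<Otimes>\<^sub>M T)) =
      (\<integral>i. \<integral>y. f i y \<partial>T \<partial>count_space UNIV)" by simp
  also have "\<dots> = (\<Sum>i. \<integral>y. f i y \<partial>T)"
    using I null(2)
    by (intro integral_count_space_nat) (auto simp: integrable_count_space_nat_iff intro!: summable_finite[of I])
  also have "\<dots> = (\<Sum>i\<in>I. \<integral>y. f i y \<partial>T)"
    using I null(2) by (intro suminf_finite) auto
  finally show ?thesis .
qed

section \<open>Symmetries of the farthest label\<close>

lemma farthest_label_comp_strict_mono:
  assumes g: "strict_mono_on S g" and d: "\<And>x y. d x y \<in> S"
  shows "farthest_label (\<lambda>x y. g (d x y)) = farthest_label d"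
proof (intro ext)
  fix v x
  have "g (d x y) < g (d x z) \<longleftrightarrow> d x y < d x z" for y z
    using strict_mono_on_less[OF g d d] .
  then show "farthest_label (\<lambda>x y. g (d x y)) v x = farthest_label d v x"
    unfolding farthest_label_def farthest_set_def is_arg_max_def by simp
qed

lemma H3_comp_strict_mono:
  assumes "strict_mono_on S g" "\<And>x y. d x y \<in> S"
  shows "H3 P (\<lambda>x y. g (d x y)) = H3 P d"
  by (simp add: H3_def label_prob_def[abs_def] farthest_label_comp_strict_mono[OF assms])

text \<open>The prototype in position \<open>n\<close> of the permuted triple is the one in position \<open>p n\<close> of the original
  triple, so \<open>p\<close> carries the farthest positions of the former to those of the latter.\<close>

lemma farthest_set_permute:
  assumes p: "p permutes {1..3}"
  shows "farthest_set d v x = p ` farthest_set d (\<lambda>n\<in>{1..3}. v (p n)) x"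
proof -
  have arg: "i \<in> farthest_set d w x \<longleftrightarrow> i \<in> {1..3} \<and> (\<forall>j\<in>{1..3}. d x (w j) \<le> d x (w i))" for i w
    by (auto simp: farthest_set_def is_arg_max_linorder)
  have bij: "p ` {1..3} = {1..3}" by (rule permutes_image[OF p])
  have *: "p i \<in> farthest_set d v x \<longleftrightarrow> i \<in> farthest_set d (\<lambda>n\<in>{1..3}. v (p n)) x" for i
  proof -
    have "p i \<in> farthest_set d v x \<longleftrightarrow> i \<in> {1..3} \<and> (\<forall>j\<in>p ` {1..3}. d x (v j) \<le> d x (v (p i)))"
      unfolding arg bij using permutes_in_image[OF p] by blast
    also have "\<dots> \<longleftrightarrow> i \<in> farthest_set d (\<lambda>n\<in>{1..3}. v (p n)) x"
      unfolding arg by auto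
    finally show ?thesis .
  qed
  show ?thesis
  proof (intro set_eqI iffI)
    fix i assume "i \<in> farthest_set d v x"
    then have "inv p i \<in> farthest_set d (\<lambda>n\<in>{1..3}. v (p n)) x"
      using * permutes_inverses(1)[OF p] by metis
    then show "i \<in> p ` farthest_set d (\<lambda>n\<in>{1..3}. v (p n)) x"
      using permutes_inverses(1)[OF p] by (metis image_eqI)
  next
    fix i assume "i \<in> p ` farthest_set d (\<lambda>n\<in>{1..3}. v (p n)) x"
    then show "i \<in> farthest_set d v x" using * by auto
  qed
qed

lemma pmf_farthest_label_permute:
  assumes p: "p permutes {1..3}"
  shows "pmf (farthest_label d (\<lambda>n\<in>{1..3}. v (p n)) x) i = pmf (farthest_label d v x) (p i)"
proof -
  let ?w = "\<lambda>n\<in>{1..3}. v (p n)"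
  have "farthest_label d v x = map_pmf p (farthest_label d ?w x)"
    unfolding farthest_label_def
    by (subst farthest_set_permute[OF p], subst map_pmf_of_set_inj) (simp_all add: permutes_inj_on[OF p])
  then show ?thesis
    by (simp add: pmf_map_inj' permutes_inj[OF p])
qed

section \<open>The conditional label probabilities\<close>

context metric_prob_space
begin

lemma label_prob_nonneg: "0 \<le> label_prob P d v i"
  by (simp add: label_prob_def)

lemma label_prob_outside:
  assumes "v \<in> space (proto_measure P)" "i \<notin> {1..3}"
  shows "label_prob P d v i = 0"
proof -
  have "i \<notin> farthest_set d v x" for x
    by (rule contra_subsetD[OF farthest_set_subset assms(2)])
  then have "pmf (farthest_label d v x) i = 0" for x
    by (simp add: farthest_label_def)
  then have "ennreal (label_prob P d v i) = 0"
    using label_prob_eq[OF assms(1)] by simp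
  then show ?thesis
    using label_prob_nonneg[of v i] by (simp add: ennreal_eq_0_iff)
qed

lemma sum_label_prob:
  assumes v: "v \<in> space (proto_measure P)"
  shows "(\<Sum>i\<in>{1..3}. label_prob P d v i) = 1"
proof -
  have [measurable]: "(\<lambda>x. pmf (farthest_label d v x) i) \<in> borel_measurable P" for i
    using measurable_compose[OF measurable_Pair2'[OF v] measurable_compose[OF measurable_farthest_label, of "\<lambda>q. pmf q i" borel]]
    by simp
  have sum1: "(\<Sum>i\<in>{1..3}. pmf (farthest_label d v x) i) = 1" for x
    by (rule sum_pmf_eq_1) (auto simp: farthest_label_def dest: subsetD[OF farthest_set_subset])
  have "ennreal (\<Sum>i\<in>{1..3}. label_prob P d v i) = (\<Sum>i\<in>{1..3}. \<integral>\<^sup>+x. pmf (farthest_label d v x) i \<partial>P)"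
    unfolding label_prob_eq[OF v, symmetric] by (intro sum_ennreal[symmetric] label_prob_nonneg)
  also have "\<dots> = (\<integral>\<^sup>+x. (\<Sum>i\<in>{1..3}. ennreal (pmf (farthest_label d v x) i)) \<partial>P)"
    by (intro nn_integral_sum[symmetric]) measurable
  also have "\<dots> = (\<integral>\<^sup>+x. 1 \<partial>P)"
    by (intro nn_integral_cong) (subst sum_ennreal, auto simp: sum1 simp del: One_nat_def)
  also have "\<dots> = 1" by (simp add: emeasure_space_1)
  finally show ?thesis by (simp add: ennreal_eq_1)
qed

lemma label_prob_le_1:
  assumes v: "v \<in> space (proto_measure P)"
  shows "label_prob P d v i \<le> 1"
proof (cases "i \<in> {1..3}")
  case True
  then have "label_prob P d v i \<le> (\<Sum>i\<in>{1..3}. label_prob P d v i)"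
    by (intro member_le_sum label_prob_nonneg) auto
  then show ?thesis by (simp only: sum_label_prob[OF v])
qed (simp add: label_prob_outside[OF v])

lemma measurable_label_prob [measurable]:
  "(\<lambda>v. label_prob P d v i) \<in> borel_measurable (proto_measure P)"
proof -
  have [measurable]: "(\<lambda>p. pmf (farthest_label d (snd p) (fst p)) i) \<in> borel_measurable (P \<Otimes>\<^sub>M proto_measure P)"
    using measurable_compose[OF measurable_farthest_label, of "\<lambda>q. pmf q i" borel]
    by (simp add: split_beta')
  have "(\<lambda>p. pmf (farthest_label d (fst p) (snd p)) i) \<in> borel_measurable (proto_measure P \<Otimes>\<^sub>M P)"
    using measurable_compose[OF measurable_pair_swap',
      of "\<lambda>p. pmf (farthest_label d (snd p) (fst p)) i" P "proto_measure P" borel]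
    by (simp add: split_beta')
  then have "(\<lambda>v. \<integral>\<^sup>+x. pmf (farthest_label d v x) i \<partial>P) \<in> borel_measurable (proto_measure P)"
    by (intro borel_measurable_nn_integral) (simp add: split_beta')
  then have "(\<lambda>v. enn2real (\<integral>\<^sup>+x. pmf (farthest_label d v x) i \<partial>P)) \<in> borel_measurable (proto_measure P)"
    by measurable
  then show ?thesis
    by (rule measurable_cong[THEN iffD1, rotated])
       (simp add: label_prob_eq[symmetric] label_prob_nonneg)
qed

text \<open>The substitution \<open>v \<mapsto> v \<circ> p\<close> preserves the product measure of identical factors and turns the
  \<open>i\<close>-th conditional probability into the \<open>p i\<close>-th.\<close>

lemma nn_integral_label_prob_permute:
  assumes p: "p permutes {1..3}"
  shows "(\<integral>\<^sup>+v. label_prob P d v (p i) \<partial>proto_measure P) = (\<integral>\<^sup>+v. label_prob P d v i \<partial>proto_measure P)"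
proof -
  let ?s = "\<lambda>v. \<lambda>n\<in>{1..3}. v (p n)"
  have dist: "distr (proto_measure P) (proto_measure P) ?s = proto_measure P"
    unfolding proto_measure_def
    using p by (intro distr_PiM_reindex permutes_inj_on[OF p] prob_space_axioms)
       (auto simp: permutes_in_image simp del: atLeastAtMost_iff)
  have s [measurable]: "?s \<in> proto_measure P \<rightarrow>\<^sub>M proto_measure P"
    unfolding proto_measure_def using permutes_in_image[OF p]
    by (intro measurable_restrict measurable_component_singleton) simp
  have "(\<integral>\<^sup>+v. label_prob P d v i \<partial>proto_measure P) =
      (\<integral>\<^sup>+v. label_prob P d v i \<partial>distr (proto_measure P) (proto_measure P) ?s)"
    by (simp only: dist)
  also have "\<dots> = (\<integral>\<^sup>+v. label_prob P d (?s v) i \<partial>proto_measure P)"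
    by (rule nn_integral_distr) measurable
  also have "\<dots> = (\<integral>\<^sup>+v. label_prob P d v (p i) \<partial>proto_measure P)"
    by (intro nn_integral_cong)
       (simp only: label_prob_eq measurable_space[OF s] pmf_farthest_label_permute[OF p])
  finally show ?thesis by simp
qed

text \<open>By exchangeability the three averages agree, and they add up to \<open>1\<close>.\<close>

lemma nn_integral_label_prob:
  assumes i: "i \<in> {1..3}"
  shows "(\<integral>\<^sup>+v. label_prob P d v i \<partial>proto_measure P) = ennreal (1 / 3)"
proof -
  interpret Q: prob_space "proto_measure P" by (rule prob_space_proto_measure)
  let ?c = "\<integral>\<^sup>+v. label_prob P d v i \<partial>proto_measure P"
  \<comment> \<open>the transposition of \<open>i\<close> and \<open>j\<close> exchanges the two averages\<close>
  have eq: "(\<integral>\<^sup>+v. label_prob P d v j \<partial>proto_measure P) = ?c" if "j \<in> {1..3}" for j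
    using nn_integral_label_prob_permute[OF permutes_swap_id[OF i that], of i] by simp
  have "3 * ?c = (\<Sum>j\<in>{1..3::nat}. \<integral>\<^sup>+v. label_prob P d v j \<partial>proto_measure P)"
    by (subst sum.cong[OF refl eq]) auto
  also have "\<dots> = (\<integral>\<^sup>+v. (\<Sum>j\<in>{1..3}. ennreal (label_prob P d v j)) \<partial>proto_measure P)"
    by (intro nn_integral_sum[symmetric]) measurable
  also have "\<dots> = (\<integral>\<^sup>+v. 1 \<partial>proto_measure P)"
    by (intro nn_integral_cong) (subst sum_ennreal, auto simp: sum_label_prob label_prob_nonneg simp del: One_nat_def)
  also have "\<dots> = 1" by (simp add: Q.emeasure_space_1)
  finally have "3 * ?c = 1" .
  then have "ennreal (1 / 3) * (3 * ?c) = ennreal (1 / 3)" by simp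
  moreover have "ennreal (1 / 3) * 3 = 1"
    using ennreal_mult[of "1/3" 3] by simp
  ultimately show ?thesis by (simp only: mult.assoc[symmetric]) simp
qed

section \<open>Entropy deficit and mutual information\<close>

text \<open>On \<open>[0, 1]\<close> the function \<open>t ln (c t)\<close> is bounded by \<open>\<bar>ln c\<bar> + 1\<close>. The scale \<open>c = 1\<close> serves the
  entropy, the scale \<open>c = 3\<close> the divergence from the uniform law.\<close>

lemma integrable_label_prob_ln:
  "integrable (proto_measure P) (\<lambda>v. label_prob P d v i * ln (c * label_prob P d v i))"
  if "0 < c" for c :: real
proof -
  interpret Q: prob_space "proto_measure P" by (rule prob_space_proto_measure)
  have bound: "\<bar>t * ln (c * t)\<bar> \<le> \<bar>ln c\<bar> + 1" if t: "0 \<le> t" "t \<le> 1" for t :: real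
  proof (cases "t = 0")
    case False
    then have "0 < t" using t by simp
    then have "t * ln (c * t) = t * ln c + t * ln t"
      using \<open>0 < c\<close> by (simp add: ln_mult algebra_simps)
    moreover have "\<bar>t * ln t\<bar> \<le> 1"
      using mult_ln_ge_minus_one[OF t(1)] t \<open>0 < t\<close> mult_nonneg_nonpos[of t "ln t"] by simp
    moreover have "\<bar>t * ln c\<bar> \<le> \<bar>ln c\<bar>"
      using t mult_right_mono[of t 1 "\<bar>ln c\<bar>"] by (simp add: abs_mult)
    ultimately show ?thesis by linarith
  qed simp
  show ?thesis
    by (rule Q.integrable_const_bound[of _ "\<bar>ln c\<bar> + 1"])
       (auto intro!: AE_I2 bound simp: label_prob_nonneg label_prob_le_1)
qed

lemma integrable_entropy:
  "integrable (proto_measure P) (\<lambda>v. shannon_entropy3 (label_prob P d v))"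
  unfolding shannon_entropy3_def using integrable_label_prob_ln[of 1]
  by (intro integrable_minus integrable_sum) simp

lemma ln3_minus_H3:
  "ln 3 - H3 P d = (\<integral>v. ln 3 - shannon_entropy3 (label_prob P d v) \<partial>proto_measure P)"
proof -
  interpret Q: prob_space "proto_measure P" by (rule prob_space_proto_measure)
  show ?thesis
    unfolding H3_def using integrable_entropy by (subst Bochner_Integration.integral_diff) (auto simp: Q.prob_space)
qed

lemma distributed_label_protos:
  "distributed (farthest_experiment P d) (count_space UNIV \<Otimes>\<^sub>M proto_measure P)
     (\<lambda>\<omega>. (label \<omega>, protos \<omega>)) (\<lambda>p. ennreal (label_prob P d (snd p) (fst p)))"
proof -
  interpret Q: prob_space "proto_measure P" by (rule prob_space_proto_measure)
  have "distributed (farthest_experiment P d) (count_space UNIV \<Otimes>\<^sub>M proto_measure P)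
     (\<lambda>\<omega>. (label \<omega>, protos \<omega>)) (\<lambda>(i, v). ennreal (label_prob P d v i))"
  proof (rule distributed_discrete_pairI[OF Q.sigma_finite_measure_axioms])
    show "label \<in> farthest_experiment P d \<rightarrow>\<^sub>M count_space UNIV"
      unfolding measurable_cong_sets[OF sets_experiment refl] by measurable
    show "protos \<in> farthest_experiment P d \<rightarrow>\<^sub>M proto_measure P"
      unfolding measurable_cong_sets[OF sets_experiment refl] by measurable
  qed (measurable, rule label_prob_conditional)
  then show ?thesis by (simp add: split_beta')
qed

text \<open>Integrating the triple out of the joint density leaves the average of \<open>q\<^sub>i\<close>, which exchangeability
  identifies.\<close>

lemma distributed_label:
  "distributed (farthest_experiment P d) (count_space UNIV) label
     (\<lambda>i. ennreal (indicator {1..3} i / 3))"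
proof -
  interpret Q: prob_space "proto_measure P" by (rule prob_space_proto_measure)
  interpret E: prob_space "farthest_experiment P d" by (rule prob_space_experiment)
  have "(\<integral>\<^sup>+v. label_prob P d v i \<partial>proto_measure P) = ennreal (indicator {1..3} i / 3)" for i
  proof (cases "i \<in> {1..3}")
    case False
    then have "(\<integral>\<^sup>+v. label_prob P d v i \<partial>proto_measure P) = (\<integral>\<^sup>+v. 0 \<partial>proto_measure P)"
      by (intro nn_integral_cong) (simp add: label_prob_outside)
    with False show ?thesis by simp
  qed (simp add: nn_integral_label_prob)
  with E.distr_marginal1[OF sigma_finite_measure_count_space Q.sigma_finite_measure_axioms
      distributed_label_protos]
  show ?thesis by simp
qed

lemma distributed_protos:
  "distributed (farthest_experiment P d) (proto_measure P) protos (\<lambda>_. ennreal 1)"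
proof -
  interpret Q: prob_space "proto_measure P" by (rule prob_space_proto_measure)
  interpret E: prob_space "farthest_experiment P d" by (rule prob_space_experiment)
  have total: "(\<integral>\<^sup>+i. label_prob P d v i \<partial>count_space UNIV) = 1" if v: "v \<in> space (proto_measure P)" for v
  proof -
    have "(\<integral>\<^sup>+i. label_prob P d v i \<partial>count_space UNIV) = (\<Sum>i\<in>{1..3}. ennreal (label_prob P d v i))"
      using label_prob_outside[OF v] by (intro nn_integral_count_space') auto
    also have "\<dots> = 1"
      by (subst sum_ennreal) (auto simp: sum_label_prob[OF v] label_prob_nonneg simp del: One_nat_def)
    finally show ?thesis .
  qed
  have marg: "distributed (farthest_experiment P d) (proto_measure P) protos
      (\<lambda>v. \<integral>\<^sup>+i. label_prob P d v i \<partial>count_space UNIV)"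
    using E.distr_marginal2[OF sigma_finite_measure_count_space Q.sigma_finite_measure_axioms
      distributed_label_protos] by simp
  show ?thesis
    by (rule distributed_cong_density[THEN iffD1, OF _ _ _ marg])
       (auto simp: total distributed_borel_measurable[OF marg])
qed

lemma label_information_eq_deficit: "label_information P d = ln 3 - H3 P d"
proof -
  interpret Q: prob_space "proto_measure P" by (rule prob_space_proto_measure)
  interpret E: prob_space "farthest_experiment P d" by (rule prob_space_experiment)
  interpret E: information_space "farthest_experiment P d" "exp 1"
    by unfold_locales simp
  let ?q = "label_prob P d"
  let ?N = "count_space (UNIV :: nat set) \<Otimes>\<^sub>M proto_measure P"
  have "label_information P d =
      (\<integral>p. ?q (snd p) (fst p) * log (exp 1)
        (?q (snd p) (fst p) / (indicator {1..3} (fst p) / 3 * 1)) \<partial>?N)"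
    unfolding label_information_def
    by (rule E.mutual_information_distr[OF sigma_finite_measure_count_space
          Q.sigma_finite_measure_axioms distributed_label _ distributed_protos _
          distributed_label_protos]) (auto simp: label_prob_nonneg)
  \<comment> \<open>outside \<open>{1..3}\<close> the quotient divides by zero, but the joint density vanishes there as well\<close>
  also have "\<dots> = (\<integral>p. ?q (snd p) (fst p) * ln (3 * ?q (snd p) (fst p)) \<partial>?N)"
  proof (rule Bochner_Integration.integral_cong[OF refl])
    fix p assume p: "p \<in> space ?N"
    then have "?q (snd p) (fst p) = 0" if "fst p \<notin> {1..3}"
      using that by (intro label_prob_outside) (auto simp: space_pair_measure)
    then show "?q (snd p) (fst p) * log (exp 1)
        (?q (snd p) (fst p) / (indicator {1..3} (fst p) / 3 * 1)) =
        ?q (snd p) (fst p) * ln (3 * ?q (snd p) (fst p))"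
      by (cases "fst p \<in> {1..3}") (auto simp: log_def mult.commute simp del: atLeastAtMost_iff)
  qed
  also have "\<dots> = (\<Sum>i\<in>{1..3}. \<integral>v. ?q v i * ln (3 * ?q v i) \<partial>proto_measure P)"
    by (rule integral_count_space_pair_finite[OF Q.sigma_finite_measure_axioms])
       (auto simp: integrable_label_prob_ln label_prob_outside simp del: atLeastAtMost_iff)
  also have "\<dots> = (\<integral>v. (\<Sum>i\<in>{1..3}. ?q v i * ln (3 * ?q v i)) \<partial>proto_measure P)"
    by (intro Bochner_Integration.integral_sum[symmetric] integrable_label_prob_ln) simp
  also have "\<dots> = (\<integral>v. ln 3 - shannon_entropy3 (?q v) \<partial>proto_measure P)"
    by (intro Bochner_Integration.integral_cong refl entropy_deficit_eq_divergence[symmetric]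
        label_prob_nonneg sum_label_prob)
  finally show ?thesis by (simp only: ln3_minus_H3)
qed

lemma H3_nonneg: "0 \<le> H3 P d"
  unfolding H3_def
  by (intro Bochner_Integration.integral_nonneg shannon_entropy3_nonneg label_prob_nonneg label_prob_le_1)

lemma entropy_deficit_nonneg:
  "v \<in> space (proto_measure P) \<Longrightarrow> 0 \<le> ln 3 - shannon_entropy3 (label_prob P d v)"
  using shannon_entropy3_le[OF label_prob_nonneg sum_label_prob] by simp

lemma H3_le: "H3 P d \<le> ln 3"
proof -
  have "0 \<le> ln 3 - H3 P d"
    unfolding ln3_minus_H3 by (intro Bochner_Integration.integral_nonneg entropy_deficit_nonneg)
  then show ?thesis by simp
qed

lemma H3_eq_ln3_iff:
  "H3 P d = ln 3 \<longleftrightarrow> (AE v in proto_measure P. \<forall>i\<in>{1..3}. label_prob P d v i = 1 / 3)"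
proof -
  interpret Q: prob_space "proto_measure P" by (rule prob_space_proto_measure)
  have "H3 P d = ln 3 \<longleftrightarrow> (\<integral>v. ln 3 - shannon_entropy3 (label_prob P d v) \<partial>proto_measure P) = 0"
    unfolding ln3_minus_H3[symmetric] by auto
  also have "\<dots> \<longleftrightarrow> (AE v in proto_measure P. ln 3 - shannon_entropy3 (label_prob P d v) = 0)"
    by (intro integral_nonneg_eq_0_iff_AE AE_I2 entropy_deficit_nonneg
        Bochner_Integration.integrable_diff integrable_entropy) auto
  also have "\<dots> \<longleftrightarrow> (AE v in proto_measure P. \<forall>i\<in>{1..3}. label_prob P d v i = 1 / 3)"
  proof (rule AE_cong)
    fix v assume "v \<in> space (proto_measure P)"
    from shannon_entropy3_eq_ln3_iff[OF label_prob_nonneg sum_label_prob[OF this]]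
    show "ln 3 - shannon_entropy3 (label_prob P d v) = 0 \<longleftrightarrow>
        (\<forall>i\<in>{1..3}. label_prob P d v i = 1 / 3)" by auto
  qed
  finally show ?thesis .
qed

end

theorem proposition1:
  fixes P :: "'a measure" and d :: "'a \<Rightarrow> 'a \<Rightarrow> real"
  assumes "metric_prob_space P d"
  shows "ln 3 - H3 P d = label_information P d
    \<and> 0 \<le> H3 P d \<and> H3 P d \<le> ln 3
    \<and> (H3 P d = ln 3 \<longleftrightarrow>
         (AE v in proto_measure P. \<forall>i\<in>{1..3}. label_prob P d v i = 1 / 3))
    \<and> (\<forall>g :: real \<Rightarrow> real. strict_mono_on {0..} g \<longrightarrow>
         H3 P (\<lambda>x y. g (d x y)) = H3 P d)
    \<and> (\<forall>c > 0. H3 P (\<lambda>x y. c * d x y) = H3 P d)"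
proof -
  interpret metric_prob_space P d by fact
  have mono: "H3 P (\<lambda>x y. g (d x y)) = H3 P d" if "strict_mono_on {0..} g" for g :: "real \<Rightarrow> real"
    by (rule H3_comp_strict_mono[OF that]) simp
  moreover have "H3 P (\<lambda>x y. c * d x y) = H3 P d" if "0 < c" for c
    using that by (intro mono strict_mono_onI) simp
  ultimately show ?thesis
    using label_information_eq_deficit H3_nonneg H3_le H3_eq_ln3_iff by simp
qed

end
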